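(* Let $E\subset\mathbb{R}^d$ be non-empty and bounded, let $\theta\in(0,1)$, and let $0<t\le s$ be real numbers. Then $$\underline{\dim}_\theta^{t}E\ \ge\ \frac{\underline{\dim}_\theta^{s}E}{1+\left(\frac1t-\frac1s\right)\underline{\dim}_\theta^{s}E}$$ and $$\overline{\dim}_\theta^{t}E\ \ge\ \frac{\overline{\dim}_\theta^{s}E}{1+\left(\frac1t-\frac1s\right)\overline{\dim}_\theta^{s}E}.$$
   Context: Intermediate dimension profiles. For $\theta\in(0,1]$, real $\tau>0$, $0\le\sigma\le\tau$ and $0<r<1$ define, for $x\in\mathbb{R}^d$, $\phi_{r,\theta}^{\sigma,\tau}(x)=1$ if $0\le|x|<r$; $\phi_{r,\theta}^{\sigma,\tau}(x)=(r/|x|)^\sigma$ if $r\le|x|\le r^\theta$; $\phi_{r,\theta}^{\sigma,\tau}(x)=r^{\theta(\tau-\sigma)+\sigma}/|x|^\tau$ if $r^\theta\le|x|$. Let $$C_{r,\theta}^{\sigma,\tau}(E)=\left(\inf_{\mu\in\mathcal{M}(E)}\iint\phi_{r,\theta}^{\sigma,\tau}(x-y)\,d\mu(x)\,d\mu(y)\right)^{-1},$$ where $\mathcal{M}(E)$ is the set of Borel probability measures supported on $E$. For real $\tau>0$ and $E$ non-empty and bounded, the lower profile $\underline{\dim}_\theta^{\tau}E$ is the unique $\sigma\in[0,\tau]$ such that $\liminf_{r\to0}\frac{\log C_{r,\theta}^{\sigma,\tau}(E)}{-\log r}=\sigma$, and the upper profile $\overline{\dim}_\theta^{\tau}E$ is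 the unique $\sigma\in[0,\tau]$ such that $\limsup_{r\to0}\frac{\log C_{r,\theta}^{\sigma,\tau}(E)}{-\log r}=\sigma$ (existence and uniqueness are known). *)

theory Defs
  imports "HOL-Probability.Probability"
begin

definition profile_kernel ::
  "real \<Rightarrow> real \<Rightarrow> real \<Rightarrow> real \<Rightarrow> 'a::euclidean_space \<Rightarrow> real" where
  "profile_kernel \<sigma> \<tau> \<theta> r x =
     (if norm x < r then 1
      else if norm x \<le> r powr \<theta> then (r / norm x) powr \<sigma>
      else r powr (\<theta> * (\<tau> - \<sigma>) + \<sigma>) / norm x powr \<tau>)"

text \<open>
  The set \<open>E\<close> need not be Borel. The condition \<open>AE x in \<mu>. x \<in> E\<close> says that the complement of
  \<open>E\<close> is contained in a Borel set of measure zero.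
\<close>

definition prob_measures_on :: "'a::euclidean_space set \<Rightarrow> 'a measure set" where
  "prob_measures_on E =
     {\<mu>. prob_space \<mu> \<and> sets \<mu> = sets borel \<and> (AE x in \<mu>. x \<in> E)}"

text \<open>
  For \<open>0 < r < 1\<close>, \<open>0 < \<theta> \<le> 1\<close> and \<open>0 \<le> \<sigma> \<le> \<tau>\<close> the kernel is continuous with values in \<open>(0, 1]\<close>,
  so the Bochner integrals exist; for nonempty bounded \<open>E\<close> the infimum is positive.
\<close>

definition profile_capacity ::
  "real \<Rightarrow> real \<Rightarrow> real \<Rightarrow> real \<Rightarrow> 'a::euclidean_space set \<Rightarrow> real" where
  "profile_capacity \<sigma> \<tau> \<theta> r E =
     inverse (INF \<mu>\<in>prob_measures_on E. \<integral>y. (\<integral>x. profile_kernel \<sigma> \<tau> \<theta> r (x - y) \<partial>\<mu>) \<partial>\<mu>)"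

definition lower_dim_profile :: "real \<Rightarrow> real \<Rightarrow> 'a::euclidean_space set \<Rightarrow> real" where
  "lower_dim_profile \<theta> \<tau> E =
     (THE \<sigma>. \<sigma> \<in> {0..\<tau>} \<and>
        Liminf (at_right 0) (\<lambda>r. ereal (ln (profile_capacity \<sigma> \<tau> \<theta> r E) / - ln r)) = ereal \<sigma>)"

definition upper_dim_profile :: "real \<Rightarrow> real \<Rightarrow> 'a::euclidean_space set \<Rightarrow> real" where
  "upper_dim_profile \<theta> \<tau> E =
     (THE \<sigma>. \<sigma> \<in> {0..\<tau>} \<and>
        Limsup (at_right 0) (\<lambda>r. ereal (ln (profile_capacity \<sigma> \<tau> \<theta> r E) / - ln r)) = ereal \<sigma>)"

end

theory Submission imports Defs begin

text \<open>
  On a logarithmic scale, \<open>\<bar>x\<bar> = r powr u\<close>, the kernel is \<open>r powr a\<close> where \<open>a\<close> is the maximum of three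
  affine functions of \<open>u\<close> (\<open>profile_kernel_eq_powr\<close>). Comparing two kernels thus amounts to comparing
  convex piecewise affine functions, and a pointwise comparison of kernels passes to the energies of
  every measure and so to their infimum \<open>I\<close> over the measures on \<open>E\<close>. The quotient whose limit
  defines the profile is \<open>log r I\<close>, called \<open>energy_exponent\<close> below.

  Raising \<open>\<sigma>\<close> to \<open>\<sigma>'\<close> raises this exponent by an amount between \<open>0\<close> and \<open>(1 - \<theta>) * (\<sigma>' - \<sigma>)\<close>. Its lower
  and its upper limit as \<open>r\<close> tends to \<open>0\<close> are therefore contractions of \<open>{0..\<tau>}\<close> as functions of \<open>\<sigma>\<close>, with
  constant \<open>1 - \<theta> < 1\<close>. By Banach's fixed point theorem each has exactly one fixed point, which is the
  dimension profile (\<open>limit_exponent_fixed_point\<close>).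

  For the inequality, let \<open>d\<close> be the profile for \<open>s\<close>, \<open>\<kappa> = 1 + (1/t - 1/s) * d\<close> and \<open>\<sigma> = d / \<kappa>\<close>. The
  kernel with parameters \<open>\<sigma>, t\<close> at the finer scale \<open>r powr \<kappa>\<close> is at most the kernel with parameters
  \<open>d, s\<close> at scale \<open>r\<close> plus \<open>r powr d\<close> (\<open>profile_kernel_rescaled_le\<close>). At scales where the
  minimal energy of the second kernel is about \<open>r powr d\<close>, that of the first is at most about
  \<open>2 * r powr d\<close>; measured at the scale \<open>r powr \<kappa>\<close> this is the exponent \<open>d / \<kappa> = \<sigma>\<close>. So the limit exponent for \<open>t\<close> is at least \<open>\<sigma>\<close> at the
  point \<open>\<sigma>\<close>, and a contraction that does not move \<open>\<sigma>\<close> to the left has its fixed point at or to the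
  right of \<open>\<sigma>\<close> (\<open>fixed_point_inequality\<close>).
\<close>

section \<open>The kernel as a power of the scale\<close>

text \<open>
  In terms of \<open>u = log r \<bar>x\<bar>\<close>, which decreases in \<open>\<bar>x\<bar>\<close>, the exponent of the kernel is \<open>0\<close> for
  \<open>u \<ge> 1\<close> and has slope \<open>- \<sigma>\<close> on \<open>[\<theta>, 1]\<close> and \<open>- \<tau>\<close> below \<open>\<theta>\<close>. Since \<open>0 \<le> \<sigma> \<le> \<tau>\<close> it is convex, which is why a
  maximum replaces the case distinction.
\<close>

definition decay_exponent :: "real \<Rightarrow> real \<Rightarrow> real \<Rightarrow> real \<Rightarrow> real" where
  "decay_exponent \<sigma> \<tau> \<theta> u =
     max 0 (max (\<sigma> * (1 - u)) (\<sigma> * (1 - \<theta>) + \<tau> * (\<theta> - u)))"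

lemma decay_exponent_nonneg: "0 \<le> decay_exponent \<sigma> \<tau> \<theta> u"
  by (simp add: decay_exponent_def)

lemma profile_kernel_0: "0 < r \<Longrightarrow> profile_kernel \<sigma> \<tau> \<theta> r 0 = 1"
  by (simp add: profile_kernel_def)

lemma profile_kernel_eq_powr:
  assumes "0 < r" "r < 1" "0 < \<theta>" "\<theta> < 1" "0 \<le> \<sigma>" "\<sigma> \<le> \<tau>" "x \<noteq> 0"
  shows "profile_kernel \<sigma> \<tau> \<theta> r x = r powr decay_exponent \<sigma> \<tau> \<theta> (log r (norm x))"
proof -
  define u where "u = log r (norm x)"
  have n: "norm x = r powr u"
    using assms by (simp add: u_def powr_log_cancel)
  have lt: "norm x < r \<longleftrightarrow> 1 < u"
    using assms powr_less_cancel_iff[of r] unfolding n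
    by (smt (verit, best) powr_less_mono' powr_mono' powr_one)
  have le: "norm x \<le> r powr \<theta> \<longleftrightarrow> \<theta> \<le> u"
    using assms unfolding n by (smt (verit, best) powr_less_mono' powr_mono')
  consider "1 < u" | "\<theta> \<le> u" "u \<le> 1" | "u < \<theta>" by linarith
  then show ?thesis
  proof cases
    case 1
    have "\<sigma> * (1 - u) \<le> 0"
      using 1 assms by (simp add: mult_nonneg_nonpos)
    moreover have "\<sigma> * (1 - \<theta>) \<le> \<tau> * (1 - \<theta>)" "\<tau> * 1 \<le> \<tau> * u"
      using 1 assms by (auto intro!: mult_right_mono mult_left_mono simp del: mult_1_right)
    ultimately have "decay_exponent \<sigma> \<tau> \<theta> u = 0"
      by (simp add: decay_exponent_def algebra_simps)
    then show ?thesis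
      using 1 lt assms by (simp add: profile_kernel_def u_def)
  next
    case 2
    have "0 \<le> (\<tau> - \<sigma>) * (u - \<theta>)" "0 \<le> \<sigma> * (1 - u)"
      using 2 assms by simp_all
    then have "decay_exponent \<sigma> \<tau> \<theta> u = \<sigma> * (1 - u)"
      by (simp add: decay_exponent_def algebra_simps)
    moreover have "(r / norm x) powr \<sigma> = r powr (\<sigma> * (1 - u))"
    proof -
      have "r / norm x = r powr (1 - u)"
        using assms by (simp add: n powr_diff)
      then show ?thesis by (simp add: powr_powr mult.commute)
    qed
    ultimately show ?thesis
      using 2 lt le by (simp add: profile_kernel_def u_def)
  next
    case 3
    have "0 \<le> (\<tau> - \<sigma>) * (\<theta> - u)" "0 \<le> \<sigma> * (1 - u)"
      using 3 assms by simp_all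
    then have "decay_exponent \<sigma> \<tau> \<theta> u = \<theta> * (\<tau> - \<sigma>) + \<sigma> - \<tau> * u"
      by (simp add: decay_exponent_def algebra_simps)
    moreover have "r powr (\<theta> * (\<tau> - \<sigma>) + \<sigma>) / norm x powr \<tau> =
        r powr (\<theta> * (\<tau> - \<sigma>) + \<sigma> - \<tau> * u)"
      by (simp add: n powr_powr powr_diff mult.commute)
    ultimately show ?thesis
      using 3 lt le assms by (simp add: profile_kernel_def u_def)
  qed
qed

lemma profile_kernel_nonneg: "0 < r \<Longrightarrow> 0 \<le> profile_kernel \<sigma> \<tau> \<theta> r x"
  by (simp add: profile_kernel_def)

lemma profile_kernel_le_1:
  assumes "0 < r" "r < 1" "0 < \<theta>" "\<theta> < 1" "0 \<le> \<sigma>" "\<sigma> \<le> \<tau>"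
  shows "profile_kernel \<sigma> \<tau> \<theta> r x \<le> 1"
proof (cases "x = 0")
  case False
  then show ?thesis
    using assms decay_exponent_nonneg by (simp add: profile_kernel_eq_powr powr_le1)
qed (use assms in \<open>simp add: profile_kernel_0\<close>)

lemma profile_kernel_antimono:
  assumes "0 < r" "r < 1" "0 < \<theta>" "\<theta> < 1" "0 \<le> \<sigma>" "\<sigma> \<le> \<sigma>'" "\<sigma>' \<le> \<tau>"
  shows "profile_kernel \<sigma>' \<tau> \<theta> r x \<le> profile_kernel \<sigma> \<tau> \<theta> r x"
proof (cases "x = 0")
  case False
  have "decay_exponent \<sigma> \<tau> \<theta> u \<le> decay_exponent \<sigma>' \<tau> \<theta> u" for u
  proof -
    have "\<sigma> * (1 - u) \<le> max 0 (\<sigma>' * (1 - u))"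
      using assms mult_right_mono[of \<sigma> \<sigma>' "1 - u"] mult_nonneg_nonpos[of \<sigma> "1 - u"]
      by (cases "u \<le> 1") auto
    moreover have "\<sigma> * (1 - \<theta>) \<le> \<sigma>' * (1 - \<theta>)"
      using assms by (intro mult_right_mono) auto
    ultimately show ?thesis unfolding decay_exponent_def by linarith
  qed
  then show ?thesis
    using assms False by (simp add: profile_kernel_eq_powr powr_mono')
qed (use assms in \<open>simp add: profile_kernel_0\<close>)

text \<open>
  The exponents for \<open>\<sigma>\<close> and \<open>\<sigma>'\<close> agree for \<open>u \<ge> 1\<close> and their gap grows until \<open>u = \<theta>\<close>, after which both
  have slope \<open>- \<tau>\<close>. The gap \<open>(1 - \<theta>) * (\<sigma>' - \<sigma>)\<close> at \<open>u = \<theta>\<close> is therefore the largest one; the factor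
  \<open>1 - \<theta> < 1\<close> is what makes the profiles fixed points of contractions.
\<close>

lemma profile_kernel_le_change_exponent:
  assumes "0 < r" "r < 1" "0 < \<theta>" "\<theta> < 1" "0 \<le> \<sigma>" "\<sigma> \<le> \<sigma>'" "\<sigma>' \<le> \<tau>"
  shows "r powr ((1 - \<theta>) * (\<sigma>' - \<sigma>)) * profile_kernel \<sigma> \<tau> \<theta> r x \<le> profile_kernel \<sigma>' \<tau> \<theta> r x"
proof (cases "x = 0")
  case True
  then show ?thesis using assms by (simp add: profile_kernel_0 powr_le1)
next
  case False
  have "decay_exponent \<sigma>' \<tau> \<theta> u \<le> (1 - \<theta>) * (\<sigma>' - \<sigma>) + decay_exponent \<sigma> \<tau> \<theta> u" for u
  proof -
    have "0 \<le> (1 - \<theta>) * (\<sigma>' - \<sigma>)" using assms by simp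
    moreover have "\<sigma>' * (1 - u) \<le> (1 - \<theta>) * (\<sigma>' - \<sigma>) +
        max (\<sigma> * (1 - u)) (\<sigma> * (1 - \<theta>) + \<tau> * (\<theta> - u))"
    proof (cases "\<theta> \<le> u")
      case True
      have "0 \<le> (\<sigma>' - \<sigma>) * (u - \<theta>)" using assms True by simp
      then have "\<sigma>' * (1 - u) \<le> (1 - \<theta>) * (\<sigma>' - \<sigma>) + \<sigma> * (1 - u)"
        by (simp add: algebra_simps)
      then show ?thesis by linarith
    next
      case False
      have "0 \<le> (\<tau> - \<sigma>') * (\<theta> - u)" using assms False by simp
      then have "\<sigma>' * (1 - u) \<le> (1 - \<theta>) * (\<sigma>' - \<sigma>) + (\<sigma> * (1 - \<theta>) + \<tau> * (\<theta> - u))"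
        by (simp add: algebra_simps)
      then show ?thesis by linarith
    qed
    moreover have "\<sigma>' * (1 - \<theta>) = (1 - \<theta>) * (\<sigma>' - \<sigma>) + \<sigma> * (1 - \<theta>)"
      by (simp add: algebra_simps)
    ultimately show ?thesis unfolding decay_exponent_def by linarith
  qed
  then show ?thesis
    using assms False by (simp add: profile_kernel_eq_powr powr_mono' flip: powr_add)
qed

text \<open>
  A set of diameter at most \<open>D\<close> sees the kernel on the ball of radius \<open>D\<close> only. There it is of order
  at least \<open>r powr \<tau>\<close>, which keeps the limit exponents at most \<open>\<tau>\<close>.
\<close>

lemma profile_kernel_ge_on_ball:
  assumes "0 < r" "r < 1" "0 < \<theta>" "\<theta> < 1" "0 \<le> \<sigma>" "\<sigma> \<le> \<tau>" "1 \<le> D" "norm x \<le> D"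
  shows "r powr (\<tau> * (1 - log r D)) \<le> profile_kernel \<sigma> \<tau> \<theta> r x"
proof -
  have D: "log r D \<le> 0"
    using assms by (simp add: log_def divide_nonneg_neg divide_nonneg_nonpos)
  show ?thesis
  proof (cases "x = 0")
    case True
    then show ?thesis using assms D by (simp add: profile_kernel_0 powr_le1)
  next
    case False
    define u where "u = log r (norm x)"
    have u: "log r D \<le> u"
      using assms False by (simp add: u_def log_def divide_right_mono_neg)
    have "\<sigma> * (1 - u) \<le> \<sigma> * (1 - log r D)" "\<sigma> * (1 - log r D) \<le> \<tau> * (1 - log r D)"
      "\<sigma> * (1 - \<theta>) \<le> \<tau> * (1 - \<theta>)" "\<tau> * (\<theta> - u) \<le> \<tau> * (\<theta> - log r D)" "0 \<le> \<tau> * (1 - log r D)"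
      using assms u D by (auto intro!: mult_left_mono mult_right_mono)
    then have "decay_exponent \<sigma> \<tau> \<theta> u \<le> \<tau> * (1 - log r D)"
      unfolding decay_exponent_def by (simp add: algebra_simps)
    then show ?thesis
      using assms False by (simp add: profile_kernel_eq_powr powr_mono' u_def)
  qed
qed

text \<open>
  The new exponent \<open>\<rho>\<close> satisfies \<open>1/\<rho> = 1/\<sigma> + 1/t - 1/s\<close> when \<open>\<sigma>\<close> is positive, so \<open>\<sigma> \<le> s\<close> gives \<open>\<rho> \<le> t\<close>.
\<close>

lemma rescaled_exponent_le:
  fixes \<sigma> s t :: real
  assumes "0 < t" "t \<le> s" "0 \<le> \<sigma>" "\<sigma> \<le> s"
  shows "\<sigma> / (1 + (1 / t - 1 / s) * \<sigma>) \<le> t"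
proof -
  define \<kappa> where "\<kappa> = 1 + (1 / t - 1 / s) * \<sigma>"
  have "1 \<le> \<kappa>" unfolding \<kappa>_def using assms by (simp add: frac_le)
  moreover have "\<kappa> * t = \<sigma> + t * (1 - \<sigma> / s)"
    using assms by (simp add: \<kappa>_def field_simps)
  moreover have "0 \<le> t * (1 - \<sigma> / s)"
    using assms by simp
  ultimately show ?thesis unfolding \<kappa>_def[symmetric] by (simp add: divide_le_eq mult.commute)
qed

text \<open>
  The factor \<open>\<kappa>\<close> in front and the division of \<open>u\<close> by \<open>\<kappa>\<close> account for the change of scale from \<open>r\<close> to
  \<open>r powr \<kappa>\<close>. For positive \<open>u\<close>, the middle branch on the right has the same value \<open>\<sigma>\<close> at \<open>u = 0\<close> as the
  one on the left and a flatter slope; for negative \<open>u\<close> it is at least \<open>\<sigma>\<close>. The outer branches have slopes \<open>- t\<close> and \<open>- s\<close> with \<open>t \<le> s\<close>, and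
  \<open>\<kappa>\<close> is the value for which they cross exactly at height \<open>\<sigma>\<close>: to the right of the crossing point the
  flatter one is larger, to the left of it the truncation at \<open>\<sigma>\<close> takes over.
\<close>

lemma decay_exponent_rescaled:
  assumes "0 < \<theta>" "\<theta> < 1" "0 < t" "t \<le> s" "0 \<le> \<sigma>" "\<sigma> \<le> s"
  defines "\<kappa> \<equiv> 1 + (1 / t - 1 / s) * \<sigma>"
  shows "min (decay_exponent \<sigma> s \<theta> u) \<sigma> \<le> \<kappa> * decay_exponent (\<sigma> / \<kappa>) t \<theta> (u / \<kappa>)"
proof -
  have k1: "1 \<le> \<kappa>"
    unfolding \<kappa>_def using assms(1-6) by (simp add: frac_le)
  have kt: "\<kappa> * t = t + \<sigma> - t * \<sigma> / s"
    using assms(1-6) by (simp add: \<kappa>_def field_simps)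
  have "\<sigma> / \<kappa> \<le> \<sigma>" using k1 assms(5) by (simp add: divide_le_eq mult_left_le mult_le_cancel_left1)
  \<comment> \<open>\<open>b\<close> is the right-hand side as a function of the unscaled \<open>u\<close>.\<close>
  define b where "b = max 0 (max (\<sigma> - (\<sigma> / \<kappa>) * u) (\<sigma> * (1 - \<theta>) + t * (\<kappa> * \<theta> - u)))"
  have b: "\<kappa> * decay_exponent (\<sigma> / \<kappa>) t \<theta> (u / \<kappa>) = b"
  proof -
    have "\<kappa> * max 0 (max p q) = max 0 (max (\<kappa> * p) (\<kappa> * q))" for p q :: real
      using k1 by (simp add: max_mult_distrib_left)
    then show ?thesis
      using k1 by (simp add: decay_exponent_def b_def right_diff_distrib distrib_left mult.left_commute)
  qed
  have "min (\<sigma> * (1 - u)) \<sigma> \<le> \<sigma> - (\<sigma> / \<kappa>) * u"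
  proof (cases "0 \<le> u")
    case True
    then have "(\<sigma> / \<kappa>) * u \<le> \<sigma> * u"
      using \<open>\<sigma> / \<kappa> \<le> \<sigma>\<close> by (rule mult_right_mono[rotated])
    then show ?thesis by (simp add: algebra_simps)
  next
    case False
    then have "(\<sigma> / \<kappa>) * u \<le> 0"
      using k1 assms(5) by (intro mult_nonneg_nonpos) auto
    then show ?thesis by simp
  qed
  moreover have "min (\<sigma> * (1 - \<theta>) + s * (\<theta> - u)) \<sigma> \<le> \<sigma> * (1 - \<theta>) + t * (\<kappa> * \<theta> - u)"
  proof -
    \<comment> \<open>The two affine functions cross at \<open>v\<close>, where both take the value \<open>\<sigma>\<close>.\<close>
    define v where "v = \<theta> * (1 - \<sigma> / s)"
    have s: "s * v = s * \<theta> - \<sigma> * \<theta>" 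
      using assms(1-6) by (simp add: v_def field_simps)
    have "t * v = t * (\<kappa> * \<theta>) - \<sigma> * \<theta>"
    proof -
      have "t * (\<kappa> * \<theta>) = (\<kappa> * t) * \<theta>" by simp
      then show ?thesis unfolding kt v_def using assms(1-6) by (simp add: field_simps)
    qed
    moreover have "min (s * (v - u)) 0 \<le> t * (v - u)"
    proof (cases "u \<le> v")
      case False
      then show ?thesis using assms(4) mult_right_mono_neg[of t s "v - u"] by linarith
    next
      case True
      then have "0 \<le> t * (v - u)" using assms(3) by simp
      then show ?thesis by linarith
    qed
    ultimately show ?thesis using s by (simp add: algebra_simps)
  qed
  ultimately show ?thesis
    unfolding b unfolding b_def decay_exponent_def using assms(5) by linarith
qed

text \<open>
  The term \<open>r powr \<sigma>\<close> covers the points far away, where only the truncated bound of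
  \<open>decay_exponent_rescaled\<close> is available.
\<close>

lemma profile_kernel_rescaled_le:
  assumes "0 < r" "r < 1" "0 < \<theta>" "\<theta> < 1" "0 < t" "t \<le> s" "0 \<le> \<sigma>" "\<sigma> \<le> s"
  defines "\<kappa> \<equiv> 1 + (1 / t - 1 / s) * \<sigma>"
  shows "profile_kernel (\<sigma> / \<kappa>) t \<theta> (r powr \<kappa>) x \<le> profile_kernel \<sigma> s \<theta> r x + r powr \<sigma>"
proof -
  have k1: "1 \<le> \<kappa>"
    unfolding \<kappa>_def using assms(1-8) by (simp add: frac_le)
  have q: "0 < r powr \<kappa>" "r powr \<kappa> < 1"
    using assms(1,2) k1 powr_less_mono'[of r 0 \<kappa>] by auto
  show ?thesis
  proof (cases "x = 0")
    case True
    then show ?thesis using assms(1) q by (simp add: profile_kernel_0)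
  next
    case False
    define u where "u = log r (norm x)"
    have "\<sigma> / \<kappa> \<le> t"
      unfolding \<kappa>_def using assms(5-8) by (rule rescaled_exponent_le)
    moreover have "0 \<le> \<sigma> / \<kappa>" using k1 assms(7) by simp
    moreover have "log (r powr \<kappa>) (norm x) = u / \<kappa>"
      using assms(1,2) k1 False by (simp add: u_def log_def ln_powr)
    ultimately have "profile_kernel (\<sigma> / \<kappa>) t \<theta> (r powr \<kappa>) x =
        r powr (\<kappa> * decay_exponent (\<sigma> / \<kappa>) t \<theta> (u / \<kappa>))"
      using q assms(3,4) False by (simp add: profile_kernel_eq_powr powr_powr)
    also have "\<dots> \<le> r powr (min (decay_exponent \<sigma> s \<theta> u) \<sigma>)"
      unfolding \<kappa>_def using assms(1-8) by (intro powr_mono' decay_exponent_rescaled) auto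
    also have "\<dots> \<le> r powr decay_exponent \<sigma> s \<theta> u + r powr \<sigma>"
      by (simp add: min_def)
    also have "r powr decay_exponent \<sigma> s \<theta> u = profile_kernel \<sigma> s \<theta> r x"
      using assms(1-8) False by (simp add: profile_kernel_eq_powr u_def)
    finally show ?thesis .
  qed
qed


section \<open>Minimal energies\<close>

definition kernel_energy :: "('a::euclidean_space \<Rightarrow> real) \<Rightarrow> 'a measure \<Rightarrow> real" where
  "kernel_energy K \<mu> = (\<integral>y. (\<integral>x. K (x - y) \<partial>\<mu>) \<partial>\<mu>)"

definition min_energy :: "('a::euclidean_space \<Rightarrow> real) \<Rightarrow> 'a set \<Rightarrow> real" where
  "min_energy K E = (INF \<mu>\<in>prob_measures_on E. kernel_energy K \<mu>)"

text \<open>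
  Measurability and values in \<open>[0, 1]\<close> make all integrals below exist, and bound every energy.
\<close>

definition admissible_kernel :: "('a::euclidean_space \<Rightarrow> real) \<Rightarrow> bool" where
  "admissible_kernel K \<longleftrightarrow> K \<in> borel_measurable borel \<and> (\<forall>x. 0 \<le> K x \<and> K x \<le> 1)"

lemma admissible_profile_kernel:
  assumes "0 < r" "r < 1" "0 < \<theta>" "\<theta> < 1" "0 \<le> \<sigma>" "\<sigma> \<le> \<tau>"
  shows "admissible_kernel (profile_kernel \<sigma> \<tau> \<theta> r :: 'a::euclidean_space \<Rightarrow> real)"
proof -
  have "(profile_kernel \<sigma> \<tau> \<theta> r :: 'a \<Rightarrow> real) \<in> borel_measurable borel"
    unfolding profile_kernel_def[abs_def] by measurable
  then show ?thesis
    using assms by (simp add: admissible_kernel_def profile_kernel_nonneg profile_kernel_le_1)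
qed

lemma prob_measures_on_nonempty:
  assumes "E \<noteq> {}"
  shows "prob_measures_on E \<noteq> {}"
proof -
  obtain x where "x \<in> E" using assms by blast
  have "prob_space (return borel x)" by (rule prob_space_return) simp
  \<comment> \<open>The null set has to be Borel, so it is the complement of the point rather than that of \<open>E\<close>.\<close>
  moreover have "AE y in return borel x. y \<in> E"
    by (rule AE_I'[where N = "- {x}"]) (use \<open>x \<in> E\<close> in \<open>auto simp: null_sets_def\<close>)
  ultimately have "return borel x \<in> prob_measures_on E"
    by (simp add: prob_measures_on_def)
  then show ?thesis by blast
qed

context
  fixes E :: "'a::euclidean_space set" and \<mu> :: "'a measure"
  assumes \<mu>: "\<mu> \<in> prob_measures_on E"
begin

interpretation prob_space \<mu> using \<mu> by (simp add: prob_measures_on_def)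

lemma sets_eq_borel[measurable_cong]: "sets \<mu> = sets borel"
  using \<mu> by (simp add: prob_measures_on_def)

lemma integrable_translated_kernel:
  assumes "admissible_kernel K"
  shows "integrable \<mu> (\<lambda>x. K (x - y))"
proof (rule integrable_const_bound[where B = 1])
  have [measurable]: "K \<in> borel_measurable borel"
    using assms by (simp add: admissible_kernel_def)
  show "(\<lambda>x. K (x - y)) \<in> borel_measurable \<mu>" by measurable
qed (use assms in \<open>simp add: admissible_kernel_def\<close>)

lemma potential_bounds:
  assumes "admissible_kernel K"
  shows "0 \<le> (\<integral>x. K (x - y) \<partial>\<mu>)" "(\<integral>x. K (x - y) \<partial>\<mu>) \<le> 1"
  using integral_ge_const[OF integrable_translated_kernel[OF assms], of 0 y]
    integral_le_const[OF integrable_translated_kernel[OF assms], of y 1] assms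
  by (auto simp: admissible_kernel_def)

lemma integrable_potential:
  assumes "admissible_kernel K"
  shows "integrable \<mu> (\<lambda>y. \<integral>x. K (x - y) \<partial>\<mu>)"
proof (rule integrable_const_bound[where B = 1])
  have [measurable]: "K \<in> borel_measurable borel"
    using assms by (simp add: admissible_kernel_def)
  show "(\<lambda>y. \<integral>x. K (x - y) \<partial>\<mu>) \<in> borel_measurable \<mu>" by measurable
qed (use potential_bounds[OF assms] in simp)

lemma kernel_energy_bounds:
  assumes "admissible_kernel K"
  shows "0 \<le> kernel_energy K \<mu>" "kernel_energy K \<mu> \<le> 1"
  unfolding kernel_energy_def using potential_bounds[OF assms]
  by (auto intro!: integral_ge_const integral_le_const integrable_potential[OF assms])

lemma kernel_energy_ge:
  assumes K: "admissible_kernel K" and c: "\<And>x y. x \<in> E \<Longrightarrow> y \<in> E \<Longrightarrow> c \<le> K (x - y)"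
  shows "c \<le> kernel_energy K \<mu>"
proof -
  have E: "AE x in \<mu>. x \<in> E" using \<mu> by (simp add: prob_measures_on_def)
  have "c \<le> (\<integral>x. K (x - y) \<partial>\<mu>)" if "y \<in> E" for y
    using integrable_translated_kernel[OF K] E c[OF _ that]
    by (intro integral_ge_const) (auto elim: AE_mp)
  then show ?thesis
    unfolding kernel_energy_def using E
    by (intro integral_ge_const integrable_potential[OF K]) (auto elim: AE_mp)
qed

lemma kernel_energy_le_affine:
  assumes K: "admissible_kernel K" and K': "admissible_kernel K'"
    and le: "\<And>x. K x \<le> a * K' x + b"
  shows "kernel_energy K \<mu> \<le> a * kernel_energy K' \<mu> + b"
proof -
  have "(\<integral>x. K (x - y) \<partial>\<mu>) \<le> a * (\<integral>x. K' (x - y) \<partial>\<mu>) + b" for y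
  proof -
    have "(\<integral>x. K (x - y) \<partial>\<mu>) \<le> (\<integral>x. a * K' (x - y) + b \<partial>\<mu>)"
      using le integrable_translated_kernel[OF K] integrable_translated_kernel[OF K']
      by (intro integral_mono) auto
    then show ?thesis
      using integrable_translated_kernel[OF K'] by (simp add: prob_space)
  qed
  then have "kernel_energy K \<mu> \<le> (\<integral>y. a * (\<integral>x. K' (x - y) \<partial>\<mu>) + b \<partial>\<mu>)"
    unfolding kernel_energy_def
    using integrable_potential[OF K] integrable_potential[OF K'] by (intro integral_mono) auto
  then show ?thesis
    using integrable_potential[OF K'] by (simp add: prob_space kernel_energy_def)
qed

end

lemma min_energy_le:
  assumes "admissible_kernel K" "\<mu> \<in> prob_measures_on E"
  shows "min_energy K E \<le> kernel_energy K \<mu>"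
  unfolding min_energy_def using assms kernel_energy_bounds(1)
  by (intro cINF_lower bdd_belowI2[where m = 0]) auto

lemma min_energy_le_1:
  assumes "E \<noteq> {}" "admissible_kernel K"
  shows "min_energy K E \<le> 1"
  using assms prob_measures_on_nonempty[of E] min_energy_le kernel_energy_bounds(2)
  by (meson ex_in_conv order_trans)

lemma min_energy_ge:
  assumes "E \<noteq> {}" "admissible_kernel K" "\<And>x y. x \<in> E \<Longrightarrow> y \<in> E \<Longrightarrow> c \<le> K (x - y)"
  shows "c \<le> min_energy K E"
  unfolding min_energy_def using assms
  by (intro cINF_greatest prob_measures_on_nonempty kernel_energy_ge) auto

text \<open>
  This is the route by which pointwise comparisons of kernels reach the capacities. The
  comparison holds for each measure with the same constants, hence for the infimum.
\<close>

lemma min_energy_le_affine: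
  assumes "E \<noteq> {}" "admissible_kernel K" "admissible_kernel K'"
    and "0 < a" "\<And>x. K x \<le> a * K' x + b"
  shows "min_energy K E \<le> a * min_energy K' E + b"
proof -
  have "(min_energy K E - b) / a \<le> min_energy K' E"
    unfolding min_energy_def[of K']
  proof (intro cINF_greatest prob_measures_on_nonempty assms)
    fix \<mu> assume \<mu>: "\<mu> \<in> prob_measures_on E"
    have "min_energy K E \<le> a * kernel_energy K' \<mu> + b"
      using min_energy_le[OF assms(2) \<mu>] kernel_energy_le_affine[OF \<mu> assms(2,3,5)] by linarith
    then show "(min_energy K E - b) / a \<le> kernel_energy K' \<mu>"
      using assms(4) by (simp add: divide_le_eq mult.commute)
  qed
  then show ?thesis using assms(4) by (simp add: divide_le_eq mult.commute)
qed

section \<open>Growth exponents of the capacities\<close>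

text \<open>
  The capacity is the inverse of the minimal energy, so this is the logarithm of the capacity divided
  by \<open>- ln r\<close>. Since \<open>r < 1\<close>, small energies correspond to large exponents.
\<close>

definition energy_exponent ::
  "real \<Rightarrow> real \<Rightarrow> real \<Rightarrow> 'a::euclidean_space set \<Rightarrow> real \<Rightarrow> real" where
  "energy_exponent \<sigma> \<tau> \<theta> E r = log r (min_energy (profile_kernel \<sigma> \<tau> \<theta> r) E)"

lemma capacity_exponent_eq:
  "ln (profile_capacity \<sigma> \<tau> \<theta> r E) / - ln r = energy_exponent \<sigma> \<tau> \<theta> E r"
  by (simp add: energy_exponent_def profile_capacity_def min_energy_def kernel_energy_def
      log_def ln_inverse)

lemma log_le_iff_powr_le:
  fixes r :: real
  assumes "0 < r" "r < 1" "0 < x" 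
  shows "log r x \<le> a \<longleftrightarrow> r powr a \<le> x" "a \<le> log r x \<longleftrightarrow> x \<le> r powr a"
proof -
  have x: "x = r powr log r x" using assms by simp
  show "log r x \<le> a \<longleftrightarrow> r powr a \<le> x"
    using assms by (subst (2) x) (smt (verit, best) powr_less_mono' powr_mono')
  show "a \<le> log r x \<longleftrightarrow> x \<le> r powr a"
    using assms by (subst (2) x) (smt (verit, best) powr_less_mono' powr_mono')
qed

lemma bounded_diameter_bound:
  fixes E :: "'a::euclidean_space set"
  assumes "bounded E"
  obtains D where "1 \<le> D" "\<And>x y. x \<in> E \<Longrightarrow> y \<in> E \<Longrightarrow> norm (x - y) \<le> D"
proof -
  obtain D where "\<forall>x\<in>E. \<forall>y\<in>E. dist x y \<le> D"
    using assms bounded_two_points by blast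
  then show thesis by (intro that[of "max 1 D"]) (auto simp: dist_norm le_max_iff_disj)
qed

context
  fixes E :: "'a::euclidean_space set" and \<theta> :: real
  assumes E: "E \<noteq> {}" "bounded E" and \<theta>: "0 < \<theta>" "\<theta> < 1"
begin

lemma min_energy_ge_powr:
  assumes "0 < r" "r < 1" "0 \<le> \<sigma>" "\<sigma> \<le> \<tau>"
    and "1 \<le> D" "\<And>x y. x \<in> E \<Longrightarrow> y \<in> E \<Longrightarrow> norm (x - y) \<le> D"
  shows "r powr (\<tau> * (1 - log r D)) \<le> min_energy (profile_kernel \<sigma> \<tau> \<theta> r) E"
  using assms \<theta> E(1)
  by (intro min_energy_ge profile_kernel_ge_on_ball admissible_profile_kernel) auto

lemma min_energy_pos:
  assumes "0 < r" "r < 1" "0 \<le> \<sigma>" "\<sigma> \<le> \<tau>"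
  shows "0 < min_energy (profile_kernel \<sigma> \<tau> \<theta> r) E"
proof -
  obtain D where "1 \<le> D" "\<And>x y. x \<in> E \<Longrightarrow> y \<in> E \<Longrightarrow> norm (x - y) \<le> D"
    using bounded_diameter_bound[OF E(2)] by blast
  from min_energy_ge_powr[OF assms this] show ?thesis
    using assms(1) by (smt (verit) powr_gt_zero)
qed

lemma energy_exponent_nonneg:
  assumes "0 < r" "r < 1" "0 \<le> \<sigma>" "\<sigma> \<le> \<tau>"
  shows "0 \<le> energy_exponent \<sigma> \<tau> \<theta> E r"
  unfolding energy_exponent_def
  using assms \<theta> min_energy_pos[OF assms] min_energy_le_1[OF E(1) admissible_profile_kernel]
  by (simp add: log_le_iff_powr_le)

lemma energy_exponent_le:
  assumes "0 < r" "r < 1" "0 \<le> \<sigma>" "\<sigma> \<le> \<tau>"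
    and "1 \<le> D" "\<And>x y. x \<in> E \<Longrightarrow> y \<in> E \<Longrightarrow> norm (x - y) \<le> D"
  shows "energy_exponent \<sigma> \<tau> \<theta> E r \<le> \<tau> * (1 - log r D)"
  unfolding energy_exponent_def
  using assms min_energy_pos[OF assms(1-4)] min_energy_ge_powr[OF assms]
  by (simp add: log_le_iff_powr_le)

lemma energy_exponent_mono:
  assumes "0 < r" "r < 1" "0 \<le> \<sigma>" "\<sigma> \<le> \<sigma>'" "\<sigma>' \<le> \<tau>"
  shows "energy_exponent \<sigma> \<tau> \<theta> E r \<le> energy_exponent \<sigma>' \<tau> \<theta> E r"
proof -
  have "min_energy (profile_kernel \<sigma>' \<tau> \<theta> r) E \<le> 1 * min_energy (profile_kernel \<sigma> \<tau> \<theta> r) E + 0"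
    using assms \<theta> E(1) profile_kernel_antimono[of r \<theta> \<sigma> \<sigma>' \<tau>]
    by (intro min_energy_le_affine admissible_profile_kernel) auto
  then show ?thesis
    unfolding energy_exponent_def
    using assms min_energy_pos[of r \<sigma> \<tau>] min_energy_pos[of r \<sigma>' \<tau>] by (simp add: log_le_iff_powr_le)
qed

lemma energy_exponent_increment_le:
  assumes "0 < r" "r < 1" "0 \<le> \<sigma>" "\<sigma> \<le> \<sigma>'" "\<sigma>' \<le> \<tau>"
  shows "energy_exponent \<sigma>' \<tau> \<theta> E r \<le> energy_exponent \<sigma> \<tau> \<theta> E r + (1 - \<theta>) * (\<sigma>' - \<sigma>)"
proof -
  define c where "c = (1 - \<theta>) * (\<sigma>' - \<sigma>)"
  have "min_energy (profile_kernel \<sigma> \<tau> \<theta> r) E \<le>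
      r powr (- c) * min_energy (profile_kernel \<sigma>' \<tau> \<theta> r) E + 0"
  proof (intro min_energy_le_affine admissible_profile_kernel)
    fix x :: 'a
    have "r powr c * profile_kernel \<sigma> \<tau> \<theta> r x \<le> profile_kernel \<sigma>' \<tau> \<theta> r x"
      unfolding c_def using assms \<theta> by (intro profile_kernel_le_change_exponent) auto
    then show "profile_kernel \<sigma> \<tau> \<theta> r x \<le> r powr (- c) * profile_kernel \<sigma>' \<tau> \<theta> r x + 0"
      using assms(1) by (simp add: powr_minus field_simps)
  qed (use assms \<theta> E(1) in auto)
  then have "r powr c * min_energy (profile_kernel \<sigma> \<tau> \<theta> r) E
      \<le> min_energy (profile_kernel \<sigma>' \<tau> \<theta> r) E"
    using assms by (simp add: powr_minus field_simps)
  then have "log r (min_energy (profile_kernel \<sigma>' \<tau> \<theta> r) E) \<le>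
      c + log r (min_energy (profile_kernel \<sigma> \<tau> \<theta> r) E)"
    using assms min_energy_pos[of r \<sigma> \<tau>] min_energy_pos[of r \<sigma>' \<tau>]
    by (simp add: log_le_iff_powr_le powr_add)
  then show ?thesis unfolding energy_exponent_def c_def by simp
qed

text \<open>
  By \<open>profile_kernel_rescaled_le\<close> the minimal energy at scale \<open>r powr \<kappa>\<close> is at most the one at scale \<open>r\<close>
  plus \<open>r powr \<sigma>\<close>, hence at most twice the larger summand. The
  maximum of the summands turns into the minimum of their exponents, and the factor \<open>2\<close> into the last
  term, which vanishes as \<open>r\<close> tends to \<open>0\<close>.
\<close>

lemma energy_exponent_rescaled:
  assumes "0 < r" "r < 1" "0 < t" "t \<le> s" "0 \<le> \<sigma>" "\<sigma> \<le> s"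
  defines "\<kappa> \<equiv> 1 + (1 / t - 1 / s) * \<sigma>"
  assumes "\<sigma> / \<kappa> \<le> t"
  shows "min (energy_exponent \<sigma> s \<theta> E r) \<sigma> \<le>
    \<kappa> * energy_exponent (\<sigma> / \<kappa>) t \<theta> E (r powr \<kappa>) + ln 2 / - ln r"
proof -
  have k1: "1 \<le> \<kappa>"
    unfolding \<kappa>_def using assms(1-6) by (simp add: frac_le)
  have q: "0 < r powr \<kappa>" "r powr \<kappa> < 1"
    using assms(1,2) k1 powr_less_mono'[of r 0 \<kappa>] by auto
  define I where "I = min_energy (profile_kernel \<sigma> s \<theta> r) E"
  define J where "J = min_energy (profile_kernel (\<sigma> / \<kappa>) t \<theta> (r powr \<kappa>)) E"
  define m where "m = min (log r I) \<sigma>"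
  have I: "0 < I" unfolding I_def using assms(1-6) by (intro min_energy_pos) auto
  have J: "0 < J" unfolding J_def using assms q k1 by (intro min_energy_pos) auto
  have "J \<le> 1 * I + r powr \<sigma>"
    unfolding I_def J_def
  proof (intro min_energy_le_affine admissible_profile_kernel)
    fix x :: 'a
    show "profile_kernel (\<sigma> / \<kappa>) t \<theta> (r powr \<kappa>) x \<le> 1 * profile_kernel \<sigma> s \<theta> r x + r powr \<sigma>"
      using profile_kernel_rescaled_le[of r \<theta> t s \<sigma> x] assms(1-6) \<theta> by (simp add: \<kappa>_def)
  qed (use assms(1-6,8) q \<theta> E(1) k1 in auto)
  moreover have "I \<le> r powr m"
    using assms(1,2) I by (simp add: m_def flip: log_le_iff_powr_le(2))
  moreover have "r powr \<sigma> \<le> r powr m"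
    using assms(1,2) by (intro powr_mono') (auto simp: m_def)
  ultimately have "J \<le> 2 * r powr m" by simp
  then have "ln J \<le> ln 2 + m * ln r"
    using J assms(1) ln_le_cancel_iff[of J "2 * r powr m"] by (simp add: ln_mult ln_powr)
  then have "m \<le> ln J / ln r + ln 2 / - ln r"
    using assms(1,2) by (simp add: field_simps)
  also have "ln J / ln r = \<kappa> * log (r powr \<kappa>) J"
    using assms(1,2) k1 by (simp add: log_def ln_powr)
  finally show ?thesis by (simp add: m_def I_def J_def energy_exponent_def)
qed

end

section \<open>Lower and upper limits as the scale tends to zero\<close>

text \<open>
  The lower and the upper profile are treated together: the argument uses only these three properties,
  which both limits share. Neither limit is additive, but adding a constant, scaling by a constant and
  truncating are continuous monotone maps, and \<open>compose\<close> covers them all.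
\<close>

locale scale_limit =
  fixes A :: "(real \<Rightarrow> ereal) \<Rightarrow> ereal"
  assumes mono: "(\<forall>\<^sub>F r in at_right 0. f r \<le> g r) \<Longrightarrow> A f \<le> A g"
    and compose: "continuous_on UNIV \<phi> \<Longrightarrow> mono \<phi> \<Longrightarrow> A (\<lambda>r. \<phi> (f r)) = \<phi> (A f)"
    and reparametrize: "0 < \<kappa> \<Longrightarrow> A (\<lambda>r. f (r powr \<kappa>)) = A f"
begin

lemma const: "A (\<lambda>_. c) = c"
  using compose[of "\<lambda>_. c"] by (simp add: mono_def)

lemma add_const: "A (\<lambda>r. f r + ereal c) = A f + ereal c"
  by (rule compose) (auto simp: mono_def add_mono continuous_on_def)

lemma mult_const: 
  assumes "0 \<le> c"
  shows "A (\<lambda>r. ereal c * f r) = ereal c * A f"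
  using assms by (intro compose) (auto simp: mono_def ereal_mult_left_mono continuous_on_def)

lemma min_const: "A (\<lambda>r. min (f r) c) = min (A f) c"
  by (rule compose) (auto simp: mono_def min.coboundedI1 intro!: continuous_intros)

lemma mono_up_to_vanishing:
  assumes le: "\<forall>\<^sub>F r in at_right 0. f r \<le> g r + ereal (h r)"
    and h: "(h \<longlongrightarrow> 0) (at_right 0)"
  shows "A f \<le> A g"
proof (rule ereal_le_epsilon2)
  fix e :: real assume "0 < e"
  then have "\<forall>\<^sub>F r in at_right 0. h r < e" using h by (simp add: order_tendsto_iff)
  with le have "\<forall>\<^sub>F r in at_right 0. f r \<le> g r + ereal e"
  proof eventually_elim
    case (elim r)
    then show ?case by (meson add_left_mono ereal_less_eq(3) less_imp_le order_trans)
  qed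
  from mono[OF this] show "A f \<le> A g + ereal e" by (simp add: add_const)
qed

end

text \<open>
  Equality is needed, not just convergence of \<open>r powr \<kappa>\<close> to \<open>0\<close>: an upper limit along a sparser family of
  scales could be smaller.
\<close>

lemma filtermap_powr_at_right_0:
  assumes "0 < \<kappa>"
  shows "filtermap (\<lambda>r::real. r powr \<kappa>) (at_right 0) = at_right 0"
proof (rule filtermap_fun_inverse)
  have *: "filterlim (\<lambda>r::real. r powr c) (at_right 0) (at_right 0)" if "0 < c" for c
  proof -
    have "((\<lambda>r::real. r powr c) \<longlongrightarrow> 0 powr c) (at_right 0)"
      using that eventually_at_right_less[of "0::real"]
      by (intro tendsto_powr' tendsto_intros) (auto elim: eventually_mono)
    moreover have "\<forall>\<^sub>F r in at_right 0. (0::real) < r powr c"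
      by (auto simp: eventually_at_right_less eventually_at intro!: exI[of _ 1])
    ultimately show ?thesis using that by (auto simp: filterlim_at elim: eventually_mono)
  qed
  show "filterlim (\<lambda>r::real. r powr \<kappa>) (at_right 0) (at_right 0)"
    "filterlim (\<lambda>r::real. r powr (1 / \<kappa>)) (at_right 0) (at_right 0)"
    using assms * by simp_all
  show "\<forall>\<^sub>F r in at_right 0. (r powr (1 / \<kappa>)) powr \<kappa> = r"
    using assms eventually_at_right_less[of "0::real"]
    by (auto simp: powr_powr elim: eventually_mono)
qed

interpretation lower: scale_limit "Liminf (at_right 0)"
proof
  fix f :: "real \<Rightarrow> ereal" and \<kappa> :: real assume k: "0 < \<kappa>"
  have "c \<le> Liminf (at_right 0) (\<lambda>r. f (r powr \<kappa>)) \<longleftrightarrow> c \<le> Liminf (at_right 0) f" for c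
    by (subst (2) filtermap_powr_at_right_0[OF k, symmetric])
      (simp add: le_Liminf_iff eventually_filtermap)
  then show "Liminf (at_right 0) (\<lambda>r. f (r powr \<kappa>)) = Liminf (at_right 0) f"
    by (meson order_antisym order_refl)
qed (auto intro: Liminf_mono Liminf_compose_continuous_mono)

interpretation upper: scale_limit "Limsup (at_right 0)"
proof
  fix f :: "real \<Rightarrow> ereal" and \<kappa> :: real assume k: "0 < \<kappa>"
  have "Limsup (at_right 0) (\<lambda>r. f (r powr \<kappa>)) \<le> c \<longleftrightarrow> Limsup (at_right 0) f \<le> c" for c
    by (subst (2) filtermap_powr_at_right_0[OF k, symmetric])
      (simp add: Limsup_le_iff eventually_filtermap)
  then show "Limsup (at_right 0) (\<lambda>r. f (r powr \<kappa>)) = Limsup (at_right 0) f"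
    by (meson order_antisym order_refl)
qed (auto intro: Limsup_mono Limsup_compose_continuous_mono)

section \<open>Dimension profiles as fixed points\<close>

lemma tendsto_divide_ln_at_right_0: "((\<lambda>r::real. c / ln r) \<longlongrightarrow> 0) (at_right 0)"
  by (intro tendsto_divide_0[OF tendsto_const] filterlim_at_bot_imp_at_infinity ln_at_0)

lemma eventually_scale_less_1: "\<forall>\<^sub>F r in at_right (0::real). 0 < r \<and> r < 1"
  by (auto simp: eventually_at intro!: exI[of _ 1])

context scale_limit
begin

definition limit_exponent :: "real \<Rightarrow> real \<Rightarrow> real \<Rightarrow> 'a::euclidean_space set \<Rightarrow> ereal" where
  "limit_exponent \<sigma> \<tau> \<theta> E = A (\<lambda>r. ereal (energy_exponent \<sigma> \<tau> \<theta> E r))"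

context
  fixes E :: "'a::euclidean_space set" and \<theta> :: real
  assumes E: "E \<noteq> {}" "bounded E" and \<theta>: "0 < \<theta>" "\<theta> < 1"
begin

lemma limit_exponent_mono:
  assumes "0 \<le> \<sigma>" "\<sigma> \<le> \<sigma>'" "\<sigma>' \<le> \<tau>"
  shows "limit_exponent \<sigma> \<tau> \<theta> E \<le> limit_exponent \<sigma>' \<tau> \<theta> E"
  unfolding limit_exponent_def
  by (rule mono, rule eventually_mono[OF eventually_scale_less_1])
    (use assms energy_exponent_mono[OF E \<theta>] in auto)

lemma limit_exponent_increment_le:
  assumes "0 \<le> \<sigma>" "\<sigma> \<le> \<sigma>'" "\<sigma>' \<le> \<tau>"
  shows "limit_exponent \<sigma>' \<tau> \<theta> E \<le> limit_exponent \<sigma> \<tau> \<theta> E + ereal ((1 - \<theta>) * (\<sigma>' - \<sigma>))"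
  unfolding limit_exponent_def add_const[symmetric]
  by (rule mono, rule eventually_mono[OF eventually_scale_less_1])
    (use assms energy_exponent_increment_le[OF E \<theta>] in auto)

lemma limit_exponent_bounds:
  assumes "0 \<le> \<sigma>" "\<sigma> \<le> \<tau>"
  shows "0 \<le> limit_exponent \<sigma> \<tau> \<theta> E" "limit_exponent \<sigma> \<tau> \<theta> E \<le> ereal \<tau>"
proof -
  have "A (\<lambda>_. 0) \<le> limit_exponent \<sigma> \<tau> \<theta> E"
    unfolding limit_exponent_def
    by (rule mono, rule eventually_mono[OF eventually_scale_less_1])
      (use assms energy_exponent_nonneg[OF E \<theta>] in auto)
  then show "0 \<le> limit_exponent \<sigma> \<tau> \<theta> E" by (simp add: const)
  obtain D where D: "1 \<le> D" "\<And>x y. x \<in> E \<Longrightarrow> y \<in> E \<Longrightarrow> norm (x - y) \<le> D"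
    using bounded_diameter_bound[OF E(2)] by blast
  have "limit_exponent \<sigma> \<tau> \<theta> E \<le> A (\<lambda>_. ereal \<tau>)"
    unfolding limit_exponent_def
  proof (rule mono_up_to_vanishing)
    show "\<forall>\<^sub>F r in at_right 0. ereal (energy_exponent \<sigma> \<tau> \<theta> E r)
        \<le> ereal \<tau> + ereal ((- \<tau> * ln D) / ln r)"
      by (rule eventually_mono[OF eventually_scale_less_1])
        (use energy_exponent_le[OF E \<theta> _ _ assms D] in \<open>simp add: log_def right_diff_distrib\<close>)
  qed (rule tendsto_divide_ln_at_right_0)
  then show "limit_exponent \<sigma> \<tau> \<theta> E \<le> ereal \<tau>" by (simp add: const)
qed

text \<open>
  The limit exponent maps \<open>{0..\<tau>}\<close> to itself and, by the two increment bounds, is a contraction with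
  constant \<open>1 - \<theta>\<close>.
\<close>

lemma limit_exponent_fixed_point:
  assumes "0 < \<tau>"
  shows "\<exists>!\<sigma>. \<sigma> \<in> {0..\<tau>} \<and> limit_exponent \<sigma> \<tau> \<theta> E = ereal \<sigma>"
proof -
  define F where "F \<sigma> = real_of_ereal (limit_exponent \<sigma> \<tau> \<theta> E)" for \<sigma>
  have F: "limit_exponent \<sigma> \<tau> \<theta> E = ereal (F \<sigma>)" "F \<sigma> \<in> {0..\<tau>}" if "\<sigma> \<in> {0..\<tau>}" for \<sigma>
    using limit_exponent_bounds[of \<sigma> \<tau>] that unfolding F_def
    by (cases "limit_exponent \<sigma> \<tau> \<theta> E"; simp)+
  have *: "dist (F \<sigma>) (F \<sigma>') \<le> (1 - \<theta>) * dist \<sigma> \<sigma>'"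
    if "\<sigma> \<in> {0..\<tau>}" "\<sigma>' \<in> {0..\<tau>}" "\<sigma> \<le> \<sigma>'" for \<sigma> \<sigma>'
    using limit_exponent_mono[of \<sigma> \<sigma>' \<tau>] limit_exponent_increment_le[of \<sigma> \<sigma>' \<tau>] that F(1)
    by (simp add: dist_real_def)
  have "\<exists>!\<sigma>\<in>{0..\<tau>}. F \<sigma> = \<sigma>"
  proof (rule Banach_fix[where c = "1 - \<theta>"])
    show "dist (F \<sigma>) (F \<sigma>') \<le> (1 - \<theta>) * dist \<sigma> \<sigma>'"
      if "\<sigma> \<in> {0..\<tau>}" "\<sigma>' \<in> {0..\<tau>}" for \<sigma> \<sigma>'
      using *[of \<sigma> \<sigma>'] *[of \<sigma>' \<sigma>] that by (cases "\<sigma> \<le> \<sigma>'") (auto simp: dist_commute)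
  qed (use assms \<theta> F(2) in \<open>auto simp: complete_eq_closed\<close>)
  then show ?thesis using F(1) by (metis ereal.inject)
qed

text \<open>
  The comparison of scales shows that \<open>\<sigma> = d / \<kappa>\<close> is at most the limit exponent for \<open>t\<close> at \<open>\<sigma>\<close>. If the
  fixed point \<open>e\<close> were smaller than \<open>\<sigma>\<close>, that limit exponent would exceed \<open>e\<close> by at most
  \<open>(1 - \<theta>) * (\<sigma> - e)\<close>, hence be smaller than \<open>\<sigma>\<close>.
\<close>

lemma fixed_point_inequality:
  assumes t: "0 < t" "t \<le> s"
    and d: "d \<in> {0..s}" "limit_exponent d s \<theta> E = ereal d"
    and e: "e \<in> {0..t}" "limit_exponent e t \<theta> E = ereal e"
  shows "d / (1 + (1 / t - 1 / s) * d) \<le> e"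
proof (rule ccontr)
  define \<kappa> where "\<kappa> = 1 + (1 / t - 1 / s) * d"
  define \<sigma> where "\<sigma> = d / \<kappa>"
  assume "\<not> d / (1 + (1 / t - 1 / s) * d) \<le> e"
  then have less: "e < \<sigma>" by (simp add: \<sigma>_def \<kappa>_def)
  have k1: "1 \<le> \<kappa>" unfolding \<kappa>_def using t d(1) by (simp add: frac_le)
  have "\<sigma> \<le> t"
    unfolding \<sigma>_def \<kappa>_def using t d(1) by (intro rescaled_exponent_le) auto
  have "A (\<lambda>r. min (ereal (energy_exponent d s \<theta> E r)) (ereal d)) \<le>
      A (\<lambda>r. ereal \<kappa> * ereal (energy_exponent \<sigma> t \<theta> E (r powr \<kappa>)))"
  proof (rule mono_up_to_vanishing)
    show "\<forall>\<^sub>F r in at_right 0. min (ereal (energy_exponent d s \<theta> E r)) (ereal d) \<le>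
        ereal \<kappa> * ereal (energy_exponent \<sigma> t \<theta> E (r powr \<kappa>)) + ereal (- ln 2 / ln r)"
      by (rule eventually_mono[OF eventually_scale_less_1])
        (use energy_exponent_rescaled[OF E \<theta> _ _ t, of _ d] d(1) \<open>\<sigma> \<le> t\<close>
          in \<open>simp add: \<sigma>_def \<kappa>_def flip: ereal_min\<close>)
  qed (rule tendsto_divide_ln_at_right_0)
  also have "\<dots> = ereal \<kappa> * limit_exponent \<sigma> t \<theta> E"
    using k1 reparametrize[of \<kappa> "\<lambda>r. ereal (energy_exponent \<sigma> t \<theta> E r)"]
      mult_const[of \<kappa> "\<lambda>r. ereal (energy_exponent \<sigma> t \<theta> E (r powr \<kappa>))"]
    by (simp add: limit_exponent_def)
  finally have "ereal d \<le> ereal \<kappa> * limit_exponent \<sigma> t \<theta> E"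
    using d(2) by (simp add: min_const limit_exponent_def)
  also have "\<dots> \<le> ereal \<kappa> * (ereal e + ereal ((1 - \<theta>) * (\<sigma> - e)))"
    using limit_exponent_increment_le[of e \<sigma> t] e less \<open>\<sigma> \<le> t\<close> k1
    by (intro ereal_mult_left_mono) auto
  finally have "d \<le> \<kappa> * (e + (1 - \<theta>) * (\<sigma> - e))" by simp
  then have "\<sigma> \<le> e + (1 - \<theta>) * (\<sigma> - e)"
    using k1 by (simp add: \<sigma>_def divide_le_eq mult.commute)
  moreover have "0 < \<theta> * (\<sigma> - e)" using less \<theta> by simp
  ultimately show False by (simp add: algebra_simps)
qed

lemma dimension_inequality:
  assumes "0 < t" "t \<le> s"
  defines "profile \<equiv> \<lambda>\<tau>. THE \<sigma>. \<sigma> \<in> {0..\<tau>} \<and> limit_exponent \<sigma> \<tau> \<theta> E = ereal \<sigma>"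
  shows "profile s / (1 + (1 / t - 1 / s) * profile s) \<le> profile t"
  using theI'[OF limit_exponent_fixed_point[of s]] theI'[OF limit_exponent_fixed_point[of t]] assms(1,2)
  unfolding profile_def by (intro fixed_point_inequality) auto

end

end

theorem theorem3p10:
  fixes E :: "(real ^ 'd) set" and \<theta> s t :: real
  assumes "E \<noteq> {}" and "bounded E"
    and "0 < \<theta>" and "\<theta> < 1"
    and "0 < t" and "t \<le> s"
  shows "lower_dim_profile \<theta> t E \<ge>
           lower_dim_profile \<theta> s E / (1 + (1 / t - 1 / s) * lower_dim_profile \<theta> s E)
       \<and> upper_dim_profile \<theta> t E \<ge>
           upper_dim_profile \<theta> s E / (1 + (1 / t - 1 / s) * upper_dim_profile \<theta> s E)"
  unfolding lower_dim_profile_def upper_dim_profile_def capacity_exponent_eq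
    lower.limit_exponent_def[symmetric] upper.limit_exponent_def[symmetric]
  using lower.dimension_inequality[OF assms] upper.dimension_inequality[OF assms] by blast

end
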